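(* Let $d\ge 1$, $0<\epsilon<1$ and $\rho>0$. There are constants $b_1,b_2>0$ and $0<r_0<1$, depending only on $d$, $\epsilon$ and $\rho$, such that for all Borel probability measures $\mu$ on $\mathbb{R}^d$ with support in $B(0,\rho)$ and all $0<r\le r_0$, $$b_1\,r^{d(1+\epsilon)}\int_{|z|\le r^{-1}}|\widehat{\mu}(z)|^2\,dz\ \le\ \int\mu(B(x,r))\,d\mu(x)\ \le\ b_2\,r^{d(1-\epsilon)}\int_{|z|\le r^{-1}}|\widehat{\mu}(z)|^2\,dz.$$
   Context: $B(x,r)$ is the closed Euclidean ball in $\mathbb{R}^d$ with centre $x$ and radius $r$. The Fourier transform of $\mu$ is $\widehat{\mu}(z)=\int e^{i x\cdot z}\,d\mu(x)$ for $z\in\mathbb{R}^d$. *)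

theory Defs
  imports "HOL-Probability.Probability"
begin

definition measure_support :: "'a::topological_space measure \<Rightarrow> 'a set" where
  "measure_support M = {x. \<forall>U. open U \<and> x \<in> U \<longrightarrow> emeasure M U > 0}"

text \<open>The library's \<open>char\<close> is this transform for measures on the real line only.\<close>

definition fourier_transform :: "'a::euclidean_space measure \<Rightarrow> 'a \<Rightarrow> complex" where
  "fourier_transform M z = (LINT x|M. exp (\<i> * complex_of_real (x \<bullet> z)))"

end

theory Submission
  imports Defs
begin

text \<open>Write \<open>\<sigma>\<close> for the law of \<open>x - y\<close> when \<open>x\<close> and \<open>y\<close> are drawn independently from \<open>\<mu>\<close>. Two things
turn the theorem into a statement about \<open>\<sigma>\<close> alone: the transform of \<open>\<sigma>\<close> is \<open>\<bar>\<mu>^\<bar>\<^sup>2\<close>, and the energy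
\<open>\<integral>\<mu>(B(x,r)) d\<mu>(x)\<close> is \<open>\<sigma>(B(0,r))\<close>. By Fubini \<open>\<integral>\<mu>^ d\<nu> = \<integral>\<nu>^ d\<mu>\<close> for all finite measures, hence
\<open>\<integral>\<bar>\<mu>^\<bar>\<^sup>2 d\<nu> = \<integral>\<nu>^ d\<sigma>\<close>, and each inequality comes from one good choice of the test measure \<open>\<nu>\<close>. The
comparison holds with the power \<open>r\<^sup>d\<close> itself; since \<open>r \<le> 1\<close>, the powers in the theorem follow.

Upper bound on the energy (\<open>energy_le_fourier_energy\<close>): let \<open>Q\<close> be uniform on the ball of radius
\<open>1/(2r)\<close> and let \<open>\<nu>\<close> be the law of a difference of two independent draws from \<open>Q\<close>. Then \<open>\<nu>^ = \<bar>Q^\<bar>\<^sup>2\<close>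
is nonnegative everywhere and at least \<open>1/4\<close> on \<open>B(0,r)\<close>, while \<open>\<nu>\<close> lives on \<open>B(0,1/r)\<close> with density
at most \<open>1/\<bar>B(0,1/(2r))\<bar>\<close>, a constant times \<open>r\<^sup>d\<close>.

Lower bound: let \<open>\<nu>\<close> have density \<open>exp(-r\<^sup>2\<bar>z\<bar>\<^sup>2/2)\<close>, which is bounded below on \<open>B(0,1/r)\<close>. This bounds
\<open>r\<^sup>d \<integral>\<bar>\<mu>^\<bar>\<^sup>2\<close> over \<open>B(0,1/r)\<close> by a Gaussian energy \<open>\<integral>exp(-\<bar>u\<bar>\<^sup>2/(2r\<^sup>2)) d\<sigma>(u)\<close>
(\<open>fourier_energy_le_gaussian_energy\<close>). It remains to see that, up to constants, \<open>\<sigma>\<close> puts no more mass on a ball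
of radius \<open>r\<close> far from the origin than on \<open>B(0,r)\<close> (\<open>gaussian_energy_le_energy\<close>). With \<open>h(t) = \<mu>(B(t,r/2))\<close> this is
\<open>\<integral>h(t) h(t - s) dt \<le> \<integral>h(t)\<^sup>2 dt\<close>, which the inequality \<open>2ab \<le> a\<^sup>2 + b\<^sup>2\<close> and translation invariance
give; averaging over \<open>s\<close> against a Gaussian of scale \<open>r\<close> recovers the Gaussian energy on the left.\<close>

section \<open>The law of a difference\<close>

lemma cball_borel [measurable]: "cball c r \<in> sets borel"
  by simp

definition difference_measure :: "'a::euclidean_space measure \<Rightarrow> 'a measure" where
  "difference_measure M = distr (M \<Otimes>\<^sub>M M) borel (\<lambda>p. fst p - snd p)"

lemma sets_difference_measure [simp, measurable_cong]: "sets (difference_measure M) = sets borel"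
  by (simp add: difference_measure_def)

lemma measurable_difference [measurable]:
  fixes M :: "'a::euclidean_space measure"
  assumes [measurable_cong]: "sets M = sets borel"
  shows "(\<lambda>p. fst p - snd p) \<in> borel_measurable (M \<Otimes>\<^sub>M M)"
  by measurable

lemma finite_difference_measure:
  fixes M :: "'a::euclidean_space measure"
  assumes "finite_measure M" and M: "sets M = sets borel"
  shows "finite_measure (difference_measure M)"
proof -
  interpret finite_measure M by fact
  have "finite_measure (M \<Otimes>\<^sub>M M)"
    by (intro finite_measure_pair_measure finite_measure_axioms)
  then show ?thesis
    unfolding difference_measure_def using measurable_difference[OF M]
    by (rule finite_measure.finite_measure_distr)
qed

lemma nn_integral_difference_measure:
  fixes M :: "'a::euclidean_space measure"
  assumes "finite_measure M" and M[measurable_cong]: "sets M = sets borel"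
    and [measurable]: "f \<in> borel_measurable borel"
  shows "(\<integral>\<^sup>+u. f u \<partial>difference_measure M) = (\<integral>\<^sup>+x. \<integral>\<^sup>+y. f (x - y) \<partial>M \<partial>M)"
proof -
  interpret finite_measure M by fact
  have "(\<integral>\<^sup>+u. f u \<partial>difference_measure M) = (\<integral>\<^sup>+p. f (fst p - snd p) \<partial>(M \<Otimes>\<^sub>M M))"
    unfolding difference_measure_def by (subst nn_integral_distr) auto
  also have "\<dots> = (\<integral>\<^sup>+x. \<integral>\<^sup>+y. f (x - y) \<partial>M \<partial>M)"
    by (subst nn_integral_fst[symmetric]) auto
  finally show ?thesis .
qed

section \<open>Fourier transforms of finite measures\<close>

lemma borel_measurable_fourier_transform:
  fixes M :: "'a::euclidean_space measure"
  assumes "finite_measure M" and [measurable_cong]: "sets M = sets borel"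
  shows "fourier_transform M \<in> borel_measurable borel"
proof -
  interpret finite_measure M by fact
  have "(\<lambda>z. LINT x|M. exp (\<i> * complex_of_real (x \<bullet> z))) \<in> borel_measurable borel"
    by (rule borel_measurable_lebesgue_integral) measurable
  then show ?thesis
    by (simp add: fourier_transform_def[abs_def])
qed

lemma integrable_fourier_kernel:
  fixes M :: "'a::euclidean_space measure"
  assumes "finite_measure M" and [measurable_cong]: "sets M = sets borel"
  shows "integrable M (\<lambda>x. exp (\<i> * complex_of_real (x \<bullet> z)))"
proof -
  interpret finite_measure M by fact
  show ?thesis
    by (rule integrable_const_bound[where B = 1]) auto
qed

lemma cmod_fourier_transform_le:
  fixes M :: "'a::euclidean_space measure"
  assumes "finite_measure M" and "sets M = sets borel"
  shows "cmod (fourier_transform M z) \<le> measure M (space M)"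
  unfolding fourier_transform_def
  using integral_norm_bound[of M "\<lambda>x. exp (\<i> * complex_of_real (x \<bullet> z))"] by simp

text \<open>Both sides are the integral of the kernel \<open>exp(\<i> x \<bullet> z)\<close> over the product measure.\<close>

lemma fourier_transform_duality:
  fixes M N :: "'a::euclidean_space measure"
  assumes "finite_measure M" and M[measurable_cong]: "sets M = sets borel"
    and "finite_measure N" and N[measurable_cong]: "sets N = sets borel"
  shows "(LINT z|N. fourier_transform M z) = (LINT x|M. fourier_transform N x)"
proof -
  interpret M: finite_measure M by fact
  interpret N: finite_measure N by fact
  interpret pair_sigma_finite M N ..
  interpret P: finite_measure "M \<Otimes>\<^sub>M N"
    by (intro finite_measure_pair_measure M.finite_measure_axioms N.finite_measure_axioms)
  have "integrable (M \<Otimes>\<^sub>M N) (\<lambda>p. exp (\<i> * complex_of_real (fst p \<bullet> snd p)))"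
    by (rule P.integrable_const_bound[where B = 1]) auto
  then have "integrable (M \<Otimes>\<^sub>M N) (\<lambda>(x, z). exp (\<i> * complex_of_real (x \<bullet> z)))"
    by (simp add: case_prod_beta')
  from Fubini_integral[OF this] show ?thesis
    by (simp add: fourier_transform_def inner_commute)
qed

lemma fourier_transform_difference_measure:
  fixes M :: "'a::euclidean_space measure"
  assumes "finite_measure M" and M[measurable_cong]: "sets M = sets borel"
  shows "fourier_transform (difference_measure M) z
    = complex_of_real ((cmod (fourier_transform M z))\<^sup>2)"
proof -
  interpret finite_measure M by fact
  interpret pair_sigma_finite M M ..
  interpret P: finite_measure "M \<Otimes>\<^sub>M M"
    by (intro finite_measure_pair_measure finite_measure_axioms)
  have int: "integrable (M \<Otimes>\<^sub>M M) (\<lambda>p. exp (\<i> * complex_of_real ((fst p - snd p) \<bullet> z)))"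
    by (rule P.integrable_const_bound[where B = 1]) auto
  have kernel: "exp (\<i> * complex_of_real ((x - y) \<bullet> z))
      = exp (\<i> * complex_of_real (x \<bullet> z)) * cnj (exp (\<i> * complex_of_real (y \<bullet> z)))" for x y
    by (simp add: exp_cnj inner_diff_left algebra_simps flip: exp_add)
  have "fourier_transform (difference_measure M) z
      = (LINT p|(M \<Otimes>\<^sub>M M). exp (\<i> * complex_of_real ((fst p - snd p) \<bullet> z)))"
    unfolding fourier_transform_def difference_measure_def
    by (subst integral_distr) auto
  also have "\<dots> = (LINT x|M. LINT y|M. exp (\<i> * complex_of_real ((x - y) \<bullet> z)))"
    using integral_fst'[OF int] by simp
  also have "\<dots> = fourier_transform M z * cnj (fourier_transform M z)"
    unfolding kernel fourier_transform_def
    by simp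
  also have "\<dots> = complex_of_real ((cmod (fourier_transform M z))\<^sup>2)"
    by (simp only: complex_norm_square)
  finally show ?thesis .
qed

lemma energy_difference_measure:
  fixes M :: "'a::euclidean_space measure"
  assumes "finite_measure M" and M[measurable_cong]: "sets M = sets borel"
  shows "(LINT x|M. measure M (cball x r)) = measure (difference_measure M) (cball 0 r)"
proof -
  interpret finite_measure M by fact
  interpret D: finite_measure "difference_measure M"
    by (rule finite_difference_measure[OF assms])
  have ball: "(\<integral>\<^sup>+y. indicator (cball 0 r) (x - y) \<partial>M) = emeasure M (cball x r)" for x
  proof -
    have "(\<lambda>y. indicator (cball 0 r) (x - y) :: ennreal) = indicator (cball x r)"
      by (simp add: fun_eq_iff indicator_def dist_norm norm_minus_commute)
    then show ?thesis
      by (simp add: M)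
  qed
  have "(\<lambda>x. \<integral>\<^sup>+y. indicator (cball 0 r) (x - y) \<partial>M) \<in> borel_measurable M"
    by measurable
  then have "(\<lambda>x. enn2real (emeasure M (cball x r))) \<in> borel_measurable M"
    unfolding ball by measurable
  then have "(LINT x|M. measure M (cball x r)) = enn2real (\<integral>\<^sup>+x. ennreal (measure M (cball x r)) \<partial>M)"
    by (intro integral_eq_nn_integral) (auto simp: measure_def)
  also have "(\<integral>\<^sup>+x. ennreal (measure M (cball x r)) \<partial>M)
      = (\<integral>\<^sup>+x. \<integral>\<^sup>+y. indicator (cball 0 r) (x - y) \<partial>M \<partial>M)"
    by (simp add: ball emeasure_eq_measure)
  also have "\<dots> = (\<integral>\<^sup>+u. indicator (cball 0 r) u \<partial>difference_measure M)"
    by (rule nn_integral_difference_measure[OF assms, symmetric]) simp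
  also have "enn2real \<dots> = measure (difference_measure M) (cball 0 r)"
    by (simp add: measure_def)
  finally show ?thesis .
qed

section \<open>Gaussian integrals\<close>

text \<open>The known characteristic function of the standard normal law, rescaled by the substitution
\<open>x \<mapsto> \<surd>c x\<close>.\<close>

lemma gaussian_real_fourier:
  fixes c t :: real
  assumes "0 < c"
  shows "has_bochner_integral lborel (\<lambda>x. complex_of_real (exp (- c * x\<^sup>2 / 2)) * exp (\<i> * (t * x)))
    (complex_of_real (sqrt (2 * pi / c) * exp (- t\<^sup>2 / (2 * c))))"
proof -
  let ?s = "sqrt c"
  have s: "0 < ?s" using assms by simp
  have "integrable std_normal_distribution (\<lambda>x. iexp (t / ?s * x))"
    by (rule finite_measure.integrable_const_bound[where B = 1])
       (auto intro!: prob_space.finite_measure prob_space_normal_density)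
  moreover have "integral\<^sup>L std_normal_distribution (\<lambda>x. iexp (t / ?s * x)) = complex_of_real (exp (- ((t / ?s)\<^sup>2) / 2))"
    using fun_cong[OF char_std_normal_distribution, of "t / ?s"] by (simp only: char_def)
  ultimately have 1: "has_bochner_integral lborel (\<lambda>x. std_normal_density x *\<^sub>R iexp (t / ?s * x))
      (complex_of_real (exp (- ((t / ?s)\<^sup>2) / 2)))"
    by (subst (asm) integrable_density, simp, simp, simp, subst (asm) integral_density)
       (simp_all add: has_bochner_integral_iff del: times_divide_eq_left)
  from lborel_has_bochner_integral_real_affine_iff[of ?s _ _ 0, THEN iffD1, OF _ 1] s
  have "has_bochner_integral lborel (\<lambda>x. std_normal_density (?s * x) *\<^sub>R iexp (t * x))
      (complex_of_real (exp (- ((t / ?s)\<^sup>2) / 2)) /\<^sub>R ?s)"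
    by simp
  from has_bochner_integral_mult_right[OF this, of "complex_of_real (sqrt (2 * pi))"]
  have "has_bochner_integral lborel (\<lambda>x. complex_of_real (sqrt (2 * pi)) * std_normal_density (?s * x) *\<^sub>R iexp (t * x))
     (complex_of_real (sqrt (2 * pi)) * (complex_of_real (exp (- ((t / ?s)\<^sup>2) / 2)) /\<^sub>R ?s))"
    by simp
  moreover have "complex_of_real (sqrt (2 * pi)) * std_normal_density (?s * x) *\<^sub>R iexp (t * x)
    = complex_of_real (exp (- c * x\<^sup>2 / 2)) * exp (\<i> * (t * x))" for x
    using assms by (simp add: std_normal_density_def scaleR_conv_of_real power_mult_distrib)
  moreover have "complex_of_real (sqrt (2 * pi)) * (complex_of_real (exp (- ((t / ?s)\<^sup>2) / 2)) /\<^sub>R ?s)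
    = complex_of_real (sqrt (2 * pi / c) * exp (- t\<^sup>2 / (2 * c)))"
    using assms by (simp add: scaleR_conv_of_real real_sqrt_divide power_divide field_simps)
  ultimately show ?thesis by simp
qed

lemma has_bochner_integral_lborel_prod:
  fixes f :: "'a::euclidean_space \<Rightarrow> real \<Rightarrow> complex"
  assumes "\<And>b. b \<in> Basis \<Longrightarrow> has_bochner_integral lborel (f b) (I b)"
  shows "has_bochner_integral lborel (\<lambda>x. \<Prod>b\<in>Basis. f b (x \<bullet> b)) (\<Prod>b\<in>Basis. I b)"
proof -
  interpret product_sigma_finite "\<lambda>_::'a. lborel :: real measure" ..
  have int: "integrable lborel (f b)" and eq: "integral\<^sup>L lborel (f b) = I b" if "b \<in> Basis" for b
    using assms[OF that] by (auto simp: has_bochner_integral_iff)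
  note [measurable] = borel_measurable_integrable[OF int]
  have *: "(\<Prod>b\<in>Basis. f b ((\<Sum>b'\<in>Basis. g b' *\<^sub>R b') \<bullet> b)) = (\<Prod>b\<in>Basis. f b (g b))" for g
    by (intro prod.cong refl) simp
  have T: "(\<lambda>g. \<Sum>b\<in>Basis. g b *\<^sub>R b :: 'a) \<in> borel_measurable (\<Pi>\<^sub>M b\<in>Basis. lborel)"
    by measurable
  show ?thesis
    unfolding lborel_eq[where 'a = 'a]
    apply (subst has_bochner_integral_distr[OF _ T])
     apply measurable
    unfolding * has_bochner_integral_iff
    using product_integrable_prod[OF finite_Basis int] product_integral_prod[OF finite_Basis int] eq
    by auto
qed

text \<open>Both the Gaussian and the exponential factor over the coordinates, so the one-dimensional
formula suffices.\<close>

lemma gaussian_fourier: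
  fixes u :: "'a::euclidean_space"
  assumes "0 < c"
  shows "has_bochner_integral lborel
      (\<lambda>z. complex_of_real (exp (- c * (norm z)\<^sup>2 / 2)) * exp (\<i> * complex_of_real (z \<bullet> u)))
      (complex_of_real (sqrt (2 * pi / c) ^ DIM('a) * exp (- (norm u)\<^sup>2 / (2 * c))))"
proof -
  have norm: "(norm v)\<^sup>2 = (\<Sum>b\<in>Basis. (v \<bullet> b)\<^sup>2)" for v :: 'a
    unfolding power2_norm_eq_inner euclidean_inner[of v v] by (simp add: power2_eq_square)
  have "has_bochner_integral lborel
      (\<lambda>z. \<Prod>b\<in>Basis. complex_of_real (exp (- c * (z \<bullet> b)\<^sup>2 / 2)) * exp (\<i> * ((u \<bullet> b) * (z \<bullet> b))))
      (\<Prod>b\<in>Basis. complex_of_real (sqrt (2 * pi / c) * exp (- (u \<bullet> b)\<^sup>2 / (2 * c))))"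
    by (rule has_bochner_integral_lborel_prod) (rule gaussian_real_fourier[OF assms])
  moreover have "(\<Prod>b\<in>Basis. complex_of_real (exp (- c * (z \<bullet> b)\<^sup>2 / 2)) * exp (\<i> * ((u \<bullet> b) * (z \<bullet> b))))
    = complex_of_real (exp (- c * (norm z)\<^sup>2 / 2)) * exp (\<i> * complex_of_real (z \<bullet> u))" for z :: 'a
    unfolding norm euclidean_inner[of z u] prod.distrib of_real_sum sum_distrib_left
      sum_divide_distrib exp_sum[OF finite_Basis] of_real_prod
    by (simp add: mult.commute)
  moreover have "(\<Prod>b\<in>Basis. complex_of_real (sqrt (2 * pi / c) * exp (- (u \<bullet> b)\<^sup>2 / (2 * c))))
    = complex_of_real (sqrt (2 * pi / c) ^ DIM('a) * exp (- (norm u)\<^sup>2 / (2 * c)))"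
    unfolding norm sum_negf[symmetric] sum_divide_distrib exp_sum[OF finite_Basis] of_real_prod[symmetric]
    by (simp add: prod.distrib)
  ultimately show ?thesis by simp
qed

lemma nn_integral_gaussian:
  assumes "0 < c"
  shows "(\<integral>\<^sup>+z. ennreal (exp (- c * (norm (z::'a::euclidean_space))\<^sup>2 / 2)) \<partial>lborel)
    = ennreal (sqrt (2 * pi / c) ^ DIM('a))"
proof -
  have "has_bochner_integral lborel (\<lambda>z::'a. complex_of_real (exp (- c * (norm z)\<^sup>2 / 2)))
     (complex_of_real (sqrt (2 * pi / c) ^ DIM('a)))"
    using gaussian_fourier[OF assms, of "0::'a"] by simp
  from has_bochner_integral_Re[OF this]
  have "has_bochner_integral lborel (\<lambda>z::'a. exp (- c * (norm z)\<^sup>2 / 2)) (sqrt (2 * pi / c) ^ DIM('a))"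
    by simp
  then show ?thesis
    by (auto simp: has_bochner_integral_iff nn_integral_eq_integral)
qed

section \<open>Fourier energies\<close>

text \<open>This is the duality for the pair \<open>\<sigma>, N\<close>, where \<open>\<sigma>\<close> is the difference law of \<open>M\<close>. It tests \<open>\<sigma>\<close>
against \<open>N\<close> on the frequency side or against the transform of \<open>N\<close> on the space side.\<close>

lemma fourier_energy_duality:
  fixes M N :: "'a::euclidean_space measure"
  assumes "finite_measure M" "sets M = sets borel" "finite_measure N" "sets N = sets borel"
  shows "complex_of_real (LINT z|N. (cmod (fourier_transform M z))\<^sup>2)
    = (LINT u|difference_measure M. fourier_transform N u)"
proof -
  have "complex_of_real (LINT z|N. (cmod (fourier_transform M z))\<^sup>2)
      = (LINT z|N. fourier_transform (difference_measure M) z)"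
    unfolding fourier_transform_difference_measure[OF assms(1,2)]
    by (rule integral_complex_of_real[symmetric])
  also have "\<dots> = (LINT u|difference_measure M. fourier_transform N u)"
    using assms by (intro fourier_transform_duality finite_difference_measure) auto
  finally show ?thesis .
qed

lemma integrable_fourier_energy:
  fixes M N :: "'a::euclidean_space measure"
  assumes "finite_measure M" "sets M = sets borel" "finite_measure N"
    and [measurable_cong]: "sets N = sets borel"
  shows "integrable N (\<lambda>z. (cmod (fourier_transform M z))\<^sup>2)"
proof -
  interpret N: finite_measure N by fact
  note [measurable] = borel_measurable_fourier_transform[OF assms(1,2)]
  show ?thesis
    by (rule N.integrable_const_bound[where B = "(measure M (space M))\<^sup>2"])
       (auto intro!: power_mono cmod_fourier_transform_le assms)
qed

lemma ennreal_fourier_energy_ball: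
  fixes M :: "'a::euclidean_space measure"
  assumes "finite_measure M" "sets M = sets borel"
  shows "ennreal (LINT z:{z. norm z \<le> R}|lborel. (cmod (fourier_transform M z))\<^sup>2)
    = (\<integral>\<^sup>+z. ennreal ((cmod (fourier_transform M z))\<^sup>2) * indicator (cball 0 R) z \<partial>lborel)"
proof -
  note [measurable] = borel_measurable_fourier_transform[OF assms]
  have eq: "{z. norm z \<le> R} = cball (0::'a) R"
    by (auto simp: dist_norm)
  have "set_integrable lborel (cball 0 R) (\<lambda>z. (cmod (fourier_transform M z))\<^sup>2)"
    unfolding set_integrable_def
  proof (rule integrableI_bounded_set_indicator[where B = "(measure M (space M))\<^sup>2"])
    show "emeasure lborel (cball (0::'a) R) < \<infinity>"
      using emeasure_bounded_finite[of "cball (0::'a) R"] by simp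
  qed (auto intro!: AE_I2 power_mono cmod_fourier_transform_le assms)
  then have "(\<integral>\<^sup>+z. ennreal (indicator (cball 0 R) z *\<^sub>R (cmod (fourier_transform M z))\<^sup>2) \<partial>lborel)
      = ennreal (LINT z:cball 0 R|lborel. (cmod (fourier_transform M z))\<^sup>2)"
    unfolding set_integrable_def set_lebesgue_integral_def by (intro nn_integral_eq_integral) auto
  moreover have "ennreal (indicator (cball 0 R) z *\<^sub>R (cmod (fourier_transform M z))\<^sup>2)
     = ennreal ((cmod (fourier_transform M z))\<^sup>2) * indicator (cball 0 R) z" for z
    by (simp add: indicator_def)
  ultimately show ?thesis
    unfolding eq by simp
qed

section \<open>Bounding the energy from above\<close>

abbreviation uniform_ball :: "real \<Rightarrow> 'a::euclidean_space measure" where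
  "uniform_ball a \<equiv> uniform_measure lborel (cball 0 a)"

lemma emeasure_cball_pos_finite:
  fixes x :: "'a::euclidean_space"
  assumes "0 < a"
  shows "emeasure lborel (cball x a) \<noteq> 0" "emeasure lborel (cball x a) \<noteq> \<infinity>"
  using assms unit_ball_vol_pos[of "real DIM('a)"]
  by (simp_all add: emeasure_cball ennreal_eq_0_iff not_le del: unit_ball_vol_pos)

lemma prob_space_uniform_ball:
  "0 < a \<Longrightarrow> prob_space (uniform_ball a :: 'a::euclidean_space measure)"
  by (rule prob_space_uniform_measure; rule emeasure_cball_pos_finite)

lemma nn_integral_reflect_translate:
  fixes f :: "'a::euclidean_space \<Rightarrow> ennreal"
  assumes [measurable]: "f \<in> borel_measurable borel"
  shows "(\<integral>\<^sup>+y. f (x - y) \<partial>lborel) = (\<integral>\<^sup>+y. f y \<partial>lborel)"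
proof -
  have "(\<integral>\<^sup>+y. f y \<partial>lborel) = (\<integral>\<^sup>+y. f y \<partial>distr lborel borel (\<lambda>y. x + (- 1) *\<^sub>R y))"
    by (subst lborel_affine[of "- 1" x]) (simp_all add: density_1)
  then show ?thesis
    by (subst (asm) nn_integral_distr) auto
qed

text \<open>The difference law of the uniform measure lives on the ball of twice the radius, and its density
is at most that of the uniform measure itself, because one of the two draws can be fixed.\<close>

lemma nn_integral_difference_uniform_ball_le:
  fixes f :: "'a::euclidean_space \<Rightarrow> ennreal"
  assumes a: "0 < a" and [measurable]: "f \<in> borel_measurable borel"
  shows "(\<integral>\<^sup>+u. f u \<partial>difference_measure (uniform_ball a))
    \<le> (\<integral>\<^sup>+u. f u * indicator (cball 0 (2 * a)) u \<partial>lborel) / emeasure lborel (cball (0::'a) a)"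
    (is "_ \<le> ?C")
proof -
  let ?Q = "uniform_ball a :: 'a measure"
  interpret prob_space ?Q by (rule prob_space_uniform_ball[OF a])
  have inner: "(\<integral>\<^sup>+y. f (x - y) \<partial>?Q) \<le> ?C" if x: "x \<in> cball 0 a" for x
  proof -
    have "(\<integral>\<^sup>+y. f (x - y) * indicator (cball 0 a) y \<partial>lborel)
        \<le> (\<integral>\<^sup>+y. f (x - y) * indicator (cball 0 (2 * a)) (x - y) \<partial>lborel)"
      using x by (intro nn_integral_mono)
        (auto simp: indicator_def intro: order_trans[OF norm_triangle_ineq4])
    also have "\<dots> = (\<integral>\<^sup>+u. f u * indicator (cball 0 (2 * a)) u \<partial>lborel)"
      by (rule nn_integral_reflect_translate) measurable
    finally show ?thesis
      by (subst nn_integral_uniform_measure) (auto intro: divide_right_mono_ennreal)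
  qed
  have "(\<integral>\<^sup>+u. f u \<partial>difference_measure ?Q) = (\<integral>\<^sup>+x. \<integral>\<^sup>+y. f (x - y) \<partial>?Q \<partial>?Q)"
    by (rule nn_integral_difference_measure) (auto intro: finite_measure_axioms)
  also have "\<dots> \<le> (\<integral>\<^sup>+x. ?C \<partial>?Q)"
    by (intro nn_integral_mono_AE AE_uniform_measureI) (auto intro!: inner)
  also have "\<dots> = ?C"
    by (simp add: emeasure_space_1[simplified])
  finally show ?thesis .
qed

text \<open>If \<open>a \<bar>u\<bar> \<le> 1/2\<close>, no phase \<open>x \<bullet> u\<close> in the average exceeds \<open>\<pi>/3\<close> in modulus, so all cosines are at
least \<open>1/2\<close> and no cancellation occurs.\<close>

lemma fourier_uniform_ball_ge_half:
  fixes u :: "'a::euclidean_space"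
  assumes a: "0 < a" and u: "a * norm u \<le> 1 / 2"
  shows "1 / 2 \<le> cmod (fourier_transform (uniform_ball a) u)"
proof -
  let ?Q = "uniform_ball a :: 'a measure"
  interpret prob_space ?Q by (rule prob_space_uniform_ball[OF a])
  have int: "integrable ?Q (\<lambda>x. exp (\<i> * complex_of_real (x \<bullet> u)))"
    by (rule integrable_fourier_kernel) (auto intro: finite_measure_axioms)
  have cos: "1 / 2 \<le> cos (x \<bullet> u)" if "x \<in> cball 0 a" for x
  proof -
    have "\<bar>x \<bullet> u\<bar> \<le> norm x * norm u"
      by (rule Cauchy_Schwarz_ineq2)
    also have "\<dots> \<le> a * norm u"
      using that by (intro mult_right_mono) auto
    finally have "\<bar>x \<bullet> u\<bar> \<le> pi / 3"
      using u pi_gt3 by simp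
    then have "cos (pi / 3) \<le> cos \<bar>x \<bullet> u\<bar>"
      by (intro cos_monotone_0_pi_le) (use pi_gt3 in auto)
    then show ?thesis
      by (simp add: cos_60)
  qed
  have "1 / 2 = (LINT x|?Q. (1 / 2 :: real))"
    using prob_space by simp
  also have "\<dots> \<le> (LINT x|?Q. Re (exp (\<i> * complex_of_real (x \<bullet> u))))"
    using integrable_Re[OF int] cos
    by (intro integral_mono_AE AE_uniform_measureI) (auto simp: Re_exp)
  also have "\<dots> = Re (fourier_transform ?Q u)"
    unfolding fourier_transform_def by (rule integral_Re[OF int])
  also have "\<dots> \<le> cmod (fourier_transform ?Q u)"
    by (rule complex_Re_le_cmod)
  finally show ?thesis .
qed

text \<open>The radius \<open>1/(2r)\<close> makes both halves fit: the transform of the uniform measure is large on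
\<open>B(0,r)\<close>, and the differences of two of its points stay in \<open>B(0,1/r)\<close>.\<close>

lemma energy_le_fourier_energy:
  fixes M :: "'a::euclidean_space measure"
  assumes M: "finite_measure M" "sets M = sets borel" and r: "0 < r"
  shows "measure (difference_measure M) (cball 0 r) * measure lborel (cball (0::'a) (1 / (2 * r)))
    \<le> 4 * (LINT z:{z. norm z \<le> 1 / r}|lborel. (cmod (fourier_transform M z))\<^sup>2)"
proof -
  define a where "a = 1 / (2 * r)"
  have a: "0 < a" using r by (simp add: a_def)
  let ?Q = "uniform_ball a :: 'a measure"
  let ?D = "difference_measure M"
  let ?V = "measure lborel (cball (0::'a) a)"
  let ?I = "LINT z:{z. norm z \<le> 1 / r}|lborel. (cmod (fourier_transform M z))\<^sup>2"
  note [measurable] = borel_measurable_fourier_transform[OF M]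
  have Q: "finite_measure ?Q" "sets ?Q = sets borel"
    using prob_space_uniform_ball[OF a] by (auto intro: prob_space.finite_measure)
  have D: "finite_measure ?D" "sets ?D = sets borel"
    by (auto intro: finite_difference_measure[OF M])
  have V: "0 < ?V" "emeasure lborel (cball (0::'a) a) = ennreal ?V"
    using a by (auto simp: emeasure_cball content_cball)
  have I: "0 \<le> ?I"
    by (auto simp: set_lebesgue_integral_def intro!: Bochner_Integration.integral_nonneg)
  have "measure ?D (cball 0 r) / 4 = (LINT u|?D. indicator (cball 0 r) u / 4)"
    by simp
  also have "\<dots> \<le> (LINT u|?D. (cmod (fourier_transform ?Q u))\<^sup>2)"
  proof (rule integral_mono)
    interpret D: finite_measure ?D by fact
    show "integrable ?D (\<lambda>u. indicator (cball 0 r) u / 4 :: real)"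
      by (rule D.integrable_const_bound[where B = 1]) (auto simp: indicator_def)
    show "integrable ?D (\<lambda>u. (cmod (fourier_transform ?Q u))\<^sup>2)"
      by (rule integrable_fourier_energy[OF Q D])
    fix u
    have "(1 / 2)\<^sup>2 \<le> (cmod (fourier_transform ?Q u))\<^sup>2" if "norm u \<le> r"
      using that r by (intro power_mono fourier_uniform_ball_ge_half a) (auto simp: a_def field_simps)
    then show "indicator (cball 0 r) u / 4 \<le> (cmod (fourier_transform ?Q u))\<^sup>2"
      by (auto simp: indicator_def power2_eq_square)
  qed
  \<comment> \<open>Swapping the roles of \<open>M\<close> and \<open>?Q\<close>: both sides pair the two difference laws with each other.\<close>
  also have "\<dots> = (LINT z|difference_measure ?Q. (cmod (fourier_transform M z))\<^sup>2)"
  proof -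
    have "complex_of_real (LINT u|?D. (cmod (fourier_transform ?Q u))\<^sup>2)
        = (LINT z|difference_measure ?Q. fourier_transform ?D z)"
      by (rule fourier_energy_duality[OF Q D])
    also have "\<dots> = complex_of_real (LINT z|difference_measure ?Q. (cmod (fourier_transform M z))\<^sup>2)"
      unfolding fourier_transform_difference_measure[OF M] by (rule integral_complex_of_real)
    finally show ?thesis
      by (simp only: of_real_eq_iff)
  qed
  finally have "ennreal (measure ?D (cball 0 r) / 4)
      \<le> ennreal (LINT z|difference_measure ?Q. (cmod (fourier_transform M z))\<^sup>2)"
    by (rule ennreal_leI)
  also have "\<dots> = (\<integral>\<^sup>+z. ennreal ((cmod (fourier_transform M z))\<^sup>2) \<partial>difference_measure ?Q)"
    by (intro nn_integral_eq_integral[symmetric] integrable_fourier_energy M finite_difference_measure Q)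
       auto
  also have "\<dots> \<le> ennreal ?I / ennreal ?V"
    using nn_integral_difference_uniform_ball_le[OF a, of "\<lambda>z. ennreal ((cmod (fourier_transform M z))\<^sup>2)"] r
    by (simp add: ennreal_fourier_energy_ball[OF M] V(2)[symmetric]) (simp add: a_def)
  also have "\<dots> = ennreal (?I / ?V)"
    by (rule divide_ennreal[OF I V(1)])
  finally have "measure ?D (cball 0 r) / 4 \<le> ?I / ?V"
    using I V(1) by (subst (asm) ennreal_le_iff) auto
  then show ?thesis
    using V(1) unfolding a_def[symmetric] by (simp add: field_simps)
qed

section \<open>Bounding the energy from below\<close>

text \<open>A translate of \<open>f\<close> has the same square integral as \<open>f\<close>, so \<open>2ab \<le> a\<^sup>2 + b\<^sup>2\<close> is enough. This is the
only place where a far-away part of the difference law is compared with its part near the origin.\<close>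

lemma nn_integral_mult_translate_le:
  fixes f :: "'a::euclidean_space \<Rightarrow> ennreal"
  assumes [measurable]: "f \<in> borel_measurable borel"
  shows "(\<integral>\<^sup>+t. f t * f (t - s) \<partial>lborel) \<le> (\<integral>\<^sup>+t. f t * f t \<partial>lborel)"
proof -
  have amgm: "2 * (a * b) \<le> a * a + b * b" for a b :: ennreal
  proof (cases a; cases b)
    fix x y :: real assume "0 \<le> x" "a = ennreal x" "0 \<le> y" "b = ennreal y"
    moreover have "2 * (x * y) \<le> x * x + y * y"
      using sum_squares_bound[of x y] by (simp add: power2_eq_square)
    ultimately show ?thesis
      by (simp add: ennreal_mult[symmetric] ennreal_plus[symmetric] ennreal_numeral[symmetric]
        del: ennreal_plus ennreal_numeral)
  qed (auto simp: ennreal_top_mult ennreal_mult_top)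
  have "(\<integral>\<^sup>+t. f (t - s) * f (t - s) \<partial>lborel) = (\<integral>\<^sup>+t. f t * f t \<partial>distr lborel borel ((+) (- s)))"
    by (subst nn_integral_distr) auto
  then have shift: "(\<integral>\<^sup>+t. f (t - s) * f (t - s) \<partial>lborel) = (\<integral>\<^sup>+t. f t * f t \<partial>lborel)"
    by (simp add: lborel_distr_plus)
  have "2 * (\<integral>\<^sup>+t. f t * f (t - s) \<partial>lborel) = (\<integral>\<^sup>+t. 2 * (f t * f (t - s)) \<partial>lborel)"
    by (subst nn_integral_cmult) auto
  also have "\<dots> \<le> (\<integral>\<^sup>+t. f t * f t + f (t - s) * f (t - s) \<partial>lborel)"
    by (intro nn_integral_mono amgm)
  also have "\<dots> = 2 * (\<integral>\<^sup>+t. f t * f t \<partial>lborel)"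
    by (subst nn_integral_add) (auto simp: shift mult_2)
  finally show ?thesis
    by (subst (asm) ennreal_mult_le_mult_iff) auto
qed

text \<open>The Gaussian weight \<open>exp(-r\<^sup>2\<bar>z\<bar>\<^sup>2/2)\<close> is at least \<open>exp(-1/2)\<close> on \<open>B(0,1/r)\<close>, and integrating against
it turns \<open>\<bar>M^\<bar>\<^sup>2\<close> into the dual Gaussian of the differences.\<close>

lemma fourier_energy_le_gaussian_energy:
  fixes M :: "'a::euclidean_space measure"
  assumes M: "finite_measure M" "sets M = sets borel" and r: "0 < r"
  shows "exp (- (1 / 2)) * (LINT z:{z. norm z \<le> 1 / r}|lborel. (cmod (fourier_transform M z))\<^sup>2)
    \<le> (sqrt (2 * pi) / r) ^ DIM('a) * (LINT u|difference_measure M. exp (- (norm u)\<^sup>2 / (2 * r\<^sup>2)))"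
proof -
  let ?w = "\<lambda>z::'a. exp (- r\<^sup>2 * (norm z)\<^sup>2 / 2)"
  let ?f = "\<lambda>z. (cmod (fourier_transform M z))\<^sup>2"
  let ?I = "LINT z:{z. norm z \<le> 1 / r}|lborel. ?f z"
  define N where "N = density lborel (\<lambda>z. ennreal (?w z))"
  note [measurable] = borel_measurable_fourier_transform[OF M]
  have N: "finite_measure N" "sets N = sets borel"
    using r by (auto intro!: finite_measureI simp: N_def emeasure_density nn_integral_gaussian[simplified])
  have FN: "fourier_transform N u
      = complex_of_real ((sqrt (2 * pi) / r) ^ DIM('a) * exp (- (norm u)\<^sup>2 / (2 * r\<^sup>2)))" for u
  proof -
    have "fourier_transform N u
        = (LINT z|lborel. complex_of_real (?w z) * exp (\<i> * complex_of_real (z \<bullet> u)))"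
      unfolding fourier_transform_def N_def
      by (subst integral_density) (auto simp: scaleR_conv_of_real)
    also have "\<dots> = complex_of_real (sqrt (2 * pi / r\<^sup>2) ^ DIM('a) * exp (- (norm u)\<^sup>2 / (2 * r\<^sup>2)))"
      using gaussian_fourier[of "r\<^sup>2" u] r by (auto simp only: has_bochner_integral_iff zero_less_power)
    finally show ?thesis
      using r by (simp add: real_sqrt_divide)
  qed
  have w: "exp (- (1 / 2)) * indicator (cball 0 (1 / r)) z \<le> ?w z" for z
  proof (cases "norm z \<le> 1 / r")
    case True
    then have "(r * norm z)\<^sup>2 \<le> 1\<^sup>2"
      using r by (intro power_mono) (auto simp: field_simps)
    then show ?thesis
      using True by (simp add: power_mult_distrib)
  qed auto
  have "ennreal (exp (- (1 / 2)) * ?I)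
      = (\<integral>\<^sup>+z. ennreal (exp (- (1 / 2))) * (ennreal (?f z) * indicator (cball 0 (1 / r)) z) \<partial>lborel)"
    unfolding ennreal_mult'[OF exp_ge_zero] ennreal_fourier_energy_ball[OF M]
    by (rule nn_integral_cmult[symmetric]) measurable
  also have "\<dots> \<le> (\<integral>\<^sup>+z. ennreal (?w z) * ennreal (?f z) \<partial>lborel)"
  proof (intro nn_integral_mono)
    fix z
    show "ennreal (exp (- (1 / 2))) * (ennreal (?f z) * indicator (cball 0 (1 / r)) z)
        \<le> ennreal (?w z) * ennreal (?f z)"
    proof (cases "z \<in> cball 0 (1 / r)")
      case True
      then show ?thesis
        using w[of z] by (auto intro!: mult_right_mono ennreal_leI)
    qed auto
  qed
  also have "\<dots> = (\<integral>\<^sup>+z. ennreal (?f z) \<partial>N)"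
    unfolding N_def by (subst nn_integral_density) auto
  also have "\<dots> = ennreal (LINT z|N. ?f z)"
    by (intro nn_integral_eq_integral integrable_fourier_energy M N) auto
  finally have "exp (- (1 / 2)) * ?I \<le> (LINT z|N. ?f z)"
    by (subst (asm) ennreal_le_iff) (auto intro!: Bochner_Integration.integral_nonneg)
  also have "complex_of_real (LINT z|N. ?f z) = complex_of_real
      ((sqrt (2 * pi) / r) ^ DIM('a) * (LINT u|difference_measure M. exp (- (norm u)\<^sup>2 / (2 * r\<^sup>2))))"
    unfolding fourier_energy_duality[OF M N] FN integral_complex_of_real integral_mult_right_zero ..
  then have "(LINT z|N. ?f z)
      = (sqrt (2 * pi) / r) ^ DIM('a) * (LINT u|difference_measure M. exp (- (norm u)\<^sup>2 / (2 * r\<^sup>2)))"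
    by (simp only: of_real_eq_iff)
  finally show ?thesis .
qed

text \<open>The loss of a factor two in the exponent, from \<open>(a + b)\<^sup>2 \<le> 2a\<^sup>2 + 2b\<^sup>2\<close>, is why the wider
Gaussian \<open>exp(-\<bar>s\<bar>\<^sup>2/(4r\<^sup>2))\<close> serves as the weight over the translations.\<close>

lemma gaussian_ge_translated:
  fixes v s :: "'a::real_normed_vector"
  assumes "0 < r" "norm s \<le> norm v + r"
  shows "exp (- (1 / 2)) * exp (- (norm v)\<^sup>2 / (2 * r\<^sup>2)) \<le> exp (- (1 / (2 * r\<^sup>2)) * (norm s)\<^sup>2 / 2)"
proof -
  have "(norm s)\<^sup>2 \<le> (norm v + r)\<^sup>2"
    using assms by (intro power_mono) auto
  also have "\<dots> \<le> 2 * (norm v)\<^sup>2 + 2 * r\<^sup>2"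
    using sum_squares_bound[of "norm v" r] by (simp add: power2_sum)
  finally have "(norm s)\<^sup>2 / (4 * r\<^sup>2) \<le> (2 * (norm v)\<^sup>2 + 2 * r\<^sup>2) / (4 * r\<^sup>2)"
    by (rule divide_right_mono) simp
  then have "- (1 / 2) + - (norm v)\<^sup>2 / (2 * r\<^sup>2) \<le> - (1 / (2 * r\<^sup>2)) * (norm s)\<^sup>2 / 2"
    using assms(1) by (simp add: add_divide_distrib)
  then show ?thesis
    by (simp only: exp_add[symmetric] exp_le_cancel_iff)
qed

text \<open>Consider the integral of \<open>w(s) [\<bar>x - t\<bar> \<le> r/2] [\<bar>y - (t - s)\<bar> \<le> r/2]\<close> over \<open>x\<close>, \<open>y\<close>, \<open>s\<close> and \<open>t\<close>, where
\<open>w\<close> is the Gaussian weight; let \<open>V\<close> be the volume of a ball of radius \<open>r/2\<close>, and \<open>h\<close> the mass that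
\<open>M\<close> gives to such a ball as a function of its centre. For fixed \<open>x\<close> and \<open>y\<close> the brackets force \<open>\<bar>s\<bar> \<le> \<bar>x - y\<bar> + r\<close>, and they hold on
a set of \<open>(s,t)\<close> of measure \<open>V\<^sup>2\<close>, so the integral is at least \<open>exp(-1/2) V\<^sup>2\<close> times the Gaussian energy. For fixed \<open>s\<close> it is a
correlation of \<open>h\<close> with its translate times \<open>w(s)\<close>, and the correlation is at most \<open>\<integral>h\<^sup>2\<close>; and \<open>\<integral>h\<^sup>2\<close> only sees pairs with
\<open>\<bar>x - y\<bar> \<le> r\<close>, each with weight at most \<open>V\<close>. One factor \<open>V\<close> cancels.\<close>

lemma gaussian_energy_le_energy:
  fixes M :: "'a::euclidean_space measure"
  assumes fin: "finite_measure M" and M[measurable_cong]: "sets M = sets borel" and r: "0 < r"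
  shows "exp (- (1 / 2)) * measure lborel (cball (0::'a) (r / 2))
      * (LINT u|difference_measure M. exp (- (norm u)\<^sup>2 / (2 * r\<^sup>2)))
    \<le> (2 * sqrt pi * r) ^ DIM('a) * measure (difference_measure M) (cball 0 r)"
proof -
  interpret finite_measure M by fact
  define P where "P = M \<Otimes>\<^sub>M M"
  have setsP [measurable_cong]: "sets P = sets (borel \<Otimes>\<^sub>M borel)"
    unfolding P_def by (intro sets_pair_measure_cong M)
  interpret P: finite_measure P
    unfolding P_def by (intro finite_measure_pair_measure finite_measure_axioms)
  interpret PL: pair_sigma_finite P "lborel :: 'a measure" ..
  let ?D = "difference_measure M"
  interpret D: finite_measure ?D by (rule finite_difference_measure[OF fin M])
  define ind :: "'a \<Rightarrow> ennreal" where "ind = indicator (cball 0 (r / 2))"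
  define w where "w = (\<lambda>s::'a. ennreal (exp (- (1 / (2 * r\<^sup>2)) * (norm s)\<^sup>2 / 2)))"
  define E where "E = (\<lambda>v::'a. exp (- (norm v)\<^sup>2 / (2 * r\<^sup>2)))"
  define h where "h = (\<lambda>t. \<integral>\<^sup>+x. ind (x - t) \<partial>M)"
  define V where "V = measure lborel (cball (0::'a) (r / 2))"
  have [measurable]: "cball (0::'a) r \<in> sets borel" "ind \<in> borel_measurable borel"
      "w \<in> borel_measurable borel" "E \<in> borel_measurable borel"
    unfolding ind_def w_def E_def by measurable
  have [measurable]: "h \<in> borel_measurable borel"
    unfolding h_def by measurable
  have V: "0 < V" "emeasure lborel (cball x (r / 2)) = ennreal V" for x :: 'a
    using r by (auto simp: emeasure_cball content_cball V_def)
  have ind_int: "(\<integral>\<^sup>+t. ind (x - t) \<partial>lborel) = ennreal V" for x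
    by (subst nn_integral_reflect_translate) (auto simp: ind_def V)
  have h_prod: "(\<integral>\<^sup>+p. ind (fst p - t) * ind (snd p - t') \<partial>P) = h t * h t'" for t t'
    unfolding P_def h_def
    by (subst nn_integral_fst[symmetric]) (auto simp: nn_integral_cmult nn_integral_multc)
  have K: "ennreal V * ennreal V * ennreal (exp (- (1 / 2)) * E (fst p - snd p))
      \<le> (\<integral>\<^sup>+s. \<integral>\<^sup>+t. w s * (ind (fst p - t) * ind (snd p - (t - s))) \<partial>lborel \<partial>lborel)" for p
  proof -
    let ?k = "ennreal (exp (- (1 / 2)) * E (fst p - snd p))"
    have k: "?k * (ind (fst p - t) * ind (snd p - (t - s))) \<le> w s * (ind (fst p - t) * ind (snd p - (t - s)))" for s t
    proof (cases "norm (fst p - t) \<le> r / 2 \<and> norm (snd p - (t - s)) \<le> r / 2")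
      case True
      have "norm s \<le> norm (snd p - (t - s)) + norm (fst p - t) + norm (fst p - snd p)"
        using norm_triangle_ineq[of "(snd p - (t - s)) - (fst p - t)" "fst p - snd p"]
          norm_triangle_ineq4[of "snd p - (t - s)" "fst p - t"] by simp
      then have "norm s \<le> norm (fst p - snd p) + r"
        using True by simp
      then show ?thesis
        unfolding w_def E_def by (intro mult_right_mono ennreal_leI gaussian_ge_translated r) auto
    qed (auto simp: ind_def indicator_def)
    have "ennreal V * ennreal V * ?k = (\<integral>\<^sup>+t. ?k * ind (fst p - t) * ennreal V \<partial>lborel)"
      by (simp add: nn_integral_cmult nn_integral_multc ind_int mult_ac)
    also have "\<dots> = (\<integral>\<^sup>+t. \<integral>\<^sup>+s. ?k * (ind (fst p - t) * ind (snd p - (t - s))) \<partial>lborel \<partial>lborel)"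
    proof (intro nn_integral_cong)
      fix t
      have "(\<integral>\<^sup>+s. ind (snd p - (t - s)) \<partial>lborel) = (\<integral>\<^sup>+s. ind s \<partial>distr lborel borel ((+) (snd p - t)))"
        by (subst nn_integral_distr) (auto simp: algebra_simps)
      also have "\<dots> = ennreal V"
        using ind_int[of 0] by (simp add: lborel_distr_plus ind_def V)
      finally show "?k * ind (fst p - t) * ennreal V = (\<integral>\<^sup>+s. ?k * (ind (fst p - t) * ind (snd p - (t - s))) \<partial>lborel)"
        by (simp add: nn_integral_cmult nn_integral_multc mult_ac)
    qed
    also have "\<dots> \<le> (\<integral>\<^sup>+t. \<integral>\<^sup>+s. w s * (ind (fst p - t) * ind (snd p - (t - s))) \<partial>lborel \<partial>lborel)"
      by (intro nn_integral_mono k)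
    also have "\<dots> = (\<integral>\<^sup>+s. \<integral>\<^sup>+t. w s * (ind (fst p - t) * ind (snd p - (t - s))) \<partial>lborel \<partial>lborel)"
      by (rule lborel_pair.Fubini') measurable
    finally show ?thesis .
  qed
  have W: "(\<integral>\<^sup>+s. w s \<partial>lborel) = ennreal ((2 * sqrt pi * r) ^ DIM('a))"
  proof -
    have "2 * pi / (1 / (2 * r\<^sup>2)) = (2 * r)\<^sup>2 * pi"
      using r by (simp add: field_simps power2_eq_square)
    then have "sqrt (2 * pi / (1 / (2 * r\<^sup>2))) = 2 * sqrt pi * r"
      using r by (simp add: real_sqrt_mult)
    then show ?thesis
      using nn_integral_gaussian[of "1 / (2 * r\<^sup>2)", where 'a = 'a] r unfolding w_def by simp
  qed
  have H: "(\<integral>\<^sup>+t. h t * h t \<partial>lborel) \<le> ennreal V * emeasure ?D (cball 0 r)"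
  proof -
    have "(\<integral>\<^sup>+t. h t * h t \<partial>lborel) = (\<integral>\<^sup>+t. \<integral>\<^sup>+p. ind (fst p - t) * ind (snd p - t) \<partial>P \<partial>lborel)"
      by (simp add: h_prod)
    also have "\<dots> = (\<integral>\<^sup>+p. \<integral>\<^sup>+t. ind (fst p - t) * ind (snd p - t) \<partial>lborel \<partial>P)"
      by (rule PL.Fubini') measurable
    also have "\<dots> \<le> (\<integral>\<^sup>+p. ennreal V * indicator (cball 0 r) (fst p - snd p) \<partial>P)"
    proof (intro nn_integral_mono)
      fix p :: "'a \<times> 'a"
      have "ind (fst p - t) * ind (snd p - t) \<le> ind (fst p - t) * indicator (cball 0 r) (fst p - snd p)" for t
        using norm_triangle_ineq4[of "fst p - t" "snd p - t"]
        by (auto simp: ind_def indicator_def)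
      then have "(\<integral>\<^sup>+t. ind (fst p - t) * ind (snd p - t) \<partial>lborel)
          \<le> (\<integral>\<^sup>+t. ind (fst p - t) * indicator (cball 0 r) (fst p - snd p) \<partial>lborel)"
        by (intro nn_integral_mono)
      then show "(\<integral>\<^sup>+t. ind (fst p - t) * ind (snd p - t) \<partial>lborel)
          \<le> ennreal V * indicator (cball 0 r) (fst p - snd p)"
        by (simp add: nn_integral_multc ind_int)
    qed
    also have "\<dots> = ennreal V * (\<integral>\<^sup>+p. indicator (cball 0 r) (fst p - snd p) \<partial>P)"
      by (rule nn_integral_cmult) measurable
    also have "(\<integral>\<^sup>+p. indicator (cball 0 r) (fst p - snd p) \<partial>P) = (\<integral>\<^sup>+u. indicator (cball 0 r) u \<partial>?D)"
      unfolding difference_measure_def P_def by (subst nn_integral_distr) auto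
    finally show ?thesis by simp
  qed
  have "ennreal V * ennreal V * ennreal (exp (- (1 / 2)) * (LINT u|?D. E u))
      = (\<integral>\<^sup>+u. ennreal V * ennreal V * ennreal (exp (- (1 / 2)) * E u) \<partial>?D)"
  proof -
    have "integrable ?D E"
      by (rule D.integrable_const_bound[where B = 1]) (auto simp: E_def)
    then have "(\<integral>\<^sup>+u. ennreal (exp (- (1 / 2)) * E u) \<partial>?D) = ennreal (LINT u|?D. exp (- (1 / 2)) * E u)"
      by (intro nn_integral_eq_integral) (auto simp: E_def)
    then show ?thesis
      by (simp add: nn_integral_cmult)
  qed
  also have "\<dots> = (\<integral>\<^sup>+p. ennreal V * ennreal V * ennreal (exp (- (1 / 2)) * E (fst p - snd p)) \<partial>P)"
    unfolding difference_measure_def P_def by (subst nn_integral_distr) auto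
  also have "\<dots> \<le> (\<integral>\<^sup>+p. \<integral>\<^sup>+s. \<integral>\<^sup>+t. w s * (ind (fst p - t) * ind (snd p - (t - s))) \<partial>lborel \<partial>lborel \<partial>P)"
    by (intro nn_integral_mono K)
  also have "\<dots> = (\<integral>\<^sup>+s. \<integral>\<^sup>+p. \<integral>\<^sup>+t. w s * (ind (fst p - t) * ind (snd p - (t - s))) \<partial>lborel \<partial>P \<partial>lborel)"
    by (rule PL.Fubini'[symmetric]) measurable
  also have "\<dots> = (\<integral>\<^sup>+s. \<integral>\<^sup>+t. \<integral>\<^sup>+p. w s * (ind (fst p - t) * ind (snd p - (t - s))) \<partial>P \<partial>lborel \<partial>lborel)"
    by (intro nn_integral_cong PL.Fubini'[symmetric]) measurable
  also have "\<dots> = (\<integral>\<^sup>+s. w s * (\<integral>\<^sup>+t. h t * h (t - s) \<partial>lborel) \<partial>lborel)"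
    by (simp add: nn_integral_cmult h_prod)
  also have "\<dots> \<le> (\<integral>\<^sup>+s. w s * (ennreal V * emeasure ?D (cball 0 r)) \<partial>lborel)"
    by (intro nn_integral_mono mult_left_mono order_trans[OF nn_integral_mult_translate_le H]) auto
  also have "\<dots> = ennreal ((2 * sqrt pi * r) ^ DIM('a)) * (ennreal V * emeasure ?D (cball 0 r))"
    by (simp add: nn_integral_multc W)
  finally have "ennreal (V * V * (exp (- (1 / 2)) * (LINT u|?D. E u)))
      \<le> ennreal ((2 * sqrt pi * r) ^ DIM('a) * (V * measure ?D (cball 0 r)))"
    using V(1) r by (simp add: D.emeasure_eq_measure ennreal_mult'' ennreal_mult' E_def)
  then have "V * (V * exp (- (1 / 2)) * (LINT u|?D. E u))
      \<le> V * ((2 * sqrt pi * r) ^ DIM('a) * measure ?D (cball 0 r))"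
    using V(1) r by (subst (asm) ennreal_le_iff) (auto simp: mult_ac)
  then show ?thesis
    using V(1) unfolding E_def[symmetric] V_def[symmetric] by (simp add: mult_ac)
qed

section \<open>Comparison with the power of the radius\<close>

lemma energy_le_power_fourier_energy:
  fixes M :: "'a::euclidean_space measure"
  assumes M: "finite_measure M" "sets M = sets borel" and r: "0 < r"
  shows "(LINT x|M. measure M (cball x r)) \<le> 4 * 2 ^ DIM('a) / unit_ball_vol (real DIM('a)) * r ^ DIM('a)
      * (LINT z:{z. norm z \<le> 1 / r}|lborel. (cmod (fourier_transform M z))\<^sup>2)"
proof -
  define S where "S = measure (difference_measure M) (cball 0 r)"
  define I where "I = (LINT z:{z. norm z \<le> 1 / r}|lborel. (cmod (fourier_transform M z))\<^sup>2)"
  define v where "v = unit_ball_vol (real DIM('a))"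
  have v: "0 < v"
    by (simp add: v_def)
  have "measure lborel (cball (0::'a) (1 / (2 * r))) = v / (2 ^ DIM('a) * r ^ DIM('a))"
    using r by (simp add: content_cball power_divide power_mult_distrib v_def)
  then have "S * (v / (2 ^ DIM('a) * r ^ DIM('a))) \<le> 4 * I"
    using energy_le_fourier_energy[OF assms] by (simp only: S_def I_def)
  then have "S \<le> 4 * 2 ^ DIM('a) / v * r ^ DIM('a) * I"
    using v r by (simp add: field_simps)
  then show ?thesis
    by (simp only: S_def I_def v_def energy_difference_measure[OF M])
qed

lemma power_fourier_energy_le_energy:
  fixes M :: "'a::euclidean_space measure"
  assumes M: "finite_measure M" "sets M = sets borel" and r: "0 < r"
  shows "exp (- 1) * unit_ball_vol (real DIM('a)) / (4 * sqrt pi * sqrt (2 * pi)) ^ DIM('a) * r ^ DIM('a)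
      * (LINT z:{z. norm z \<le> 1 / r}|lborel. (cmod (fourier_transform M z))\<^sup>2)
    \<le> (LINT x|M. measure M (cball x r))"
proof -
  let ?d = "DIM('a)"
  let ?I = "LINT z:{z. norm z \<le> 1 / r}|lborel. (cmod (fourier_transform M z))\<^sup>2"
  let ?G = "LINT u|difference_measure M. exp (- (norm u)\<^sup>2 / (2 * r\<^sup>2))"
  let ?S = "LINT x|M. measure M (cball x r)"
  define e :: real where "e = exp (- (1 / 2))"
  define v where "v = unit_ball_vol (real ?d)"
  define A where "A = sqrt (2 * pi)"
  have pos: "0 < e" "0 < v" "0 < A"
    by (simp_all add: e_def v_def A_def)
  have e: "exp (- 1) = e * e"
    by (simp add: e_def flip: exp_add)
  have 1: "e * ?I \<le> (A / r) ^ ?d * ?G"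
    using fourier_energy_le_gaussian_energy[OF assms] by (simp add: e_def A_def)
  have 2: "e * (v * (r / 2) ^ ?d) * ?G \<le> (2 * sqrt pi * r) ^ ?d * ?S"
    using gaussian_energy_le_energy[OF assms] r
    by (simp add: e_def v_def content_cball energy_difference_measure[OF M])
  have "e * v * (r / 2) ^ ?d * (e * ?I) \<le> e * v * (r / 2) ^ ?d * ((A / r) ^ ?d * ?G)"
    using pos r by (intro mult_left_mono 1) auto
  also have "\<dots> = (A / r) ^ ?d * (e * (v * (r / 2) ^ ?d) * ?G)"
    by (simp add: mult_ac)
  also have "\<dots> \<le> (A / r) ^ ?d * ((2 * sqrt pi * r) ^ ?d * ?S)"
    using pos r by (intro mult_left_mono 2) auto
  also have "\<dots> = (2 * sqrt pi * A) ^ ?d * ?S"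
    using r by (simp add: power_mult_distrib power_divide)
  finally have 3: "e * v * (r / 2) ^ ?d * (e * ?I) \<le> (2 * sqrt pi * A) ^ ?d * ?S" .
  have "(4::real) ^ ?d = 2 ^ ?d * 2 ^ ?d"
    unfolding power_mult_distrib[symmetric] by simp
  then have "e * e * v * r ^ ?d * ?I \<le> (4 * sqrt pi * A) ^ ?d * ?S"
    using 3 by (simp add: power_mult_distrib power_divide field_simps)
  moreover have "0 < (4 * sqrt pi * A) ^ ?d"
    using pos by simp
  ultimately show ?thesis
    unfolding e A_def[symmetric] v_def[symmetric] by (simp add: field_simps)
qed

text \<open>Since \<open>r < 1\<close>, the power \<open>r\<^sup>d\<close> lies between \<open>r powr (d (1 + \<epsilon>))\<close> and \<open>r powr (d (1 - \<epsilon>))\<close>.\<close>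

theorem proposition4p1:
  fixes \<epsilon> \<rho> :: real
  assumes "0 < \<epsilon>" and "\<epsilon> < 1" and "0 < \<rho>"
  shows "\<exists>b1 b2 r0 :: real. 0 < b1 \<and> 0 < b2 \<and> 0 < r0 \<and> r0 < 1 \<and>
    (\<forall>M :: (real ^ 'd) measure.
      prob_space M \<and> sets M = sets borel \<and> measure_support M \<subseteq> cball 0 \<rho> \<longrightarrow>
      (\<forall>r. 0 < r \<and> r \<le> r0 \<longrightarrow>
        b1 * r powr (real CARD('d) * (1 + \<epsilon>)) *
            (LINT z:{z. norm z \<le> 1 / r}|lborel. (cmod (fourier_transform M z))\<^sup>2)
          \<le> (LINT x|M. measure M (cball x r)) \<and>
        (LINT x|M. measure M (cball x r))
          \<le> b2 * r powr (real CARD('d) * (1 - \<epsilon>)) *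
            (LINT z:{z. norm z \<le> 1 / r}|lborel. (cmod (fourier_transform M z))\<^sup>2)))"
proof -
  define b1 where "b1 = exp (- 1) * unit_ball_vol (real CARD('d)) / (4 * sqrt pi * sqrt (2 * pi)) ^ CARD('d)"
  define b2 where "b2 = 4 * 2 ^ CARD('d) / unit_ball_vol (real CARD('d))"
  have b: "0 < b1" "0 < b2"
    by (auto simp: b1_def b2_def)
  have main: "b1 * r powr (real CARD('d) * (1 + \<epsilon>)) *
            (LINT z:{z. norm z \<le> 1 / r}|lborel. (cmod (fourier_transform M z))\<^sup>2)
          \<le> (LINT x|M. measure M (cball x r))" (is ?lower)
    "(LINT x|M. measure M (cball x r))
          \<le> b2 * r powr (real CARD('d) * (1 - \<epsilon>)) *
            (LINT z:{z. norm z \<le> 1 / r}|lborel. (cmod (fourier_transform M z))\<^sup>2)" (is ?upper)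
    if "prob_space M" and sets: "sets M = sets borel" and r: "0 < r" "r \<le> 1 / 2"
    for M :: "(real ^ 'd) measure" and r
  proof -
    let ?I = "LINT z:{z. norm z \<le> 1 / r}|lborel. (cmod (fourier_transform M z))\<^sup>2"
    have M: "finite_measure M"
      using \<open>prob_space M\<close> by (rule prob_space.finite_measure)
    have I: "0 \<le> ?I"
      by (auto simp: set_lebesgue_integral_def intro!: Bochner_Integration.integral_nonneg)
    have pow: "r ^ CARD('d) = r powr real CARD('d)"
      using r by (simp add: powr_realpow)
    have "b1 * r powr (real CARD('d) * (1 + \<epsilon>)) * ?I \<le> b1 * r ^ CARD('d) * ?I"
      unfolding pow using assms r b I
      by (intro mult_right_mono mult_left_mono powr_mono') auto
    also have "\<dots> \<le> (LINT x|M. measure M (cball x r))"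
      using power_fourier_energy_le_energy[OF M sets r(1)] by (simp add: b1_def)
    finally show ?lower .
    have "(LINT x|M. measure M (cball x r)) \<le> b2 * r ^ CARD('d) * ?I"
      using energy_le_power_fourier_energy[OF M sets r(1)] by (simp add: b2_def)
    also have "\<dots> \<le> b2 * r powr (real CARD('d) * (1 - \<epsilon>)) * ?I"
      unfolding pow using assms r b I
      by (intro mult_right_mono mult_left_mono powr_mono') auto
    finally show ?upper .
  qed
  show ?thesis
    by (rule exI[of _ b1], rule exI[of _ b2], rule exI[of _ "1 / 2"]) (use b main in auto)
qed

end
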